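(* Let $S^3$ be the topological group of unit quaternions under quaternion multiplication. There are no continuous inverse ambiguous functions $f : S^3 \to S^3$.
   Context: For a group $G$, a function $f : G \to G$ is called inverse ambiguous if it is bijective and its inverse function satisfies $f^{-1}(x) = (f(x))^{-1}$ for all $x \in G$, where the right-hand side is the group inverse of $f(x)$. Equivalently, $f(f(x)) = x^{-1}$ for all $x \in G$. Here $S^3$ is the group of norm-one elements of the quaternions $\mathbb{R} \oplus \mathbb{R}i \oplus \mathbb{R}j \oplus \mathbb{R}k$ with $i^2 = j^2 = k^2 = ijk = -1$, with the subspace topology from $\mathbb{R}^4$. *)

theory Defs
  imports "HOL-Analysis.Analysis" "HOL-Algebra.Group"
begin

text \<open>
  The quaternion a + bi + cj + dk is the vector (a, b, c, d) in \<open>real ^ 4\<close>, so that the norm and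
  the topology are the Euclidean ones.  (The index \<open>4 :: 4\<close> equals \<open>0\<close>; it is the fourth entry.)
\<close>

definition quat_mult :: "real ^ 4 \<Rightarrow> real ^ 4 \<Rightarrow> real ^ 4" where
  "quat_mult x y = vector
    [x $ 1 * y $ 1 - x $ 2 * y $ 2 - x $ 3 * y $ 3 - x $ 4 * y $ 4,
     x $ 1 * y $ 2 + x $ 2 * y $ 1 + x $ 3 * y $ 4 - x $ 4 * y $ 3,
     x $ 1 * y $ 3 - x $ 2 * y $ 4 + x $ 3 * y $ 1 + x $ 4 * y $ 2,
     x $ 1 * y $ 4 + x $ 2 * y $ 3 - x $ 3 * y $ 2 + x $ 4 * y $ 1]"

definition quat_one :: "real ^ 4" where "quat_one = vector [1, 0, 0, 0]"
definition quat_i :: "real ^ 4" where "quat_i = vector [0, 1, 0, 0]"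
definition quat_j :: "real ^ 4" where "quat_j = vector [0, 0, 1, 0]"
definition quat_k :: "real ^ 4" where "quat_k = vector [0, 0, 0, 1]"

definition unit_quaternions :: "(real ^ 4) monoid" where
  "unit_quaternions = \<lparr>carrier = {x. norm x = 1}, mult = quat_mult, one = quat_one\<rparr>"

definition inverse_ambiguous :: "('a, 'b) monoid_scheme \<Rightarrow> ('a \<Rightarrow> 'a) \<Rightarrow> bool" where
  "inverse_ambiguous G f \<longleftrightarrow>
     bij_betw f (carrier G) (carrier G) \<and>
     (\<forall>x\<in>carrier G. inv_into (carrier G) f x = m_inv G (f x))"

lemma vector_4_nth [simp]:
  "(vector [a, b, c, d] :: 'a::zero ^ 4) $ 1 = a"
  "(vector [a, b, c, d] :: 'a::zero ^ 4) $ 2 = b"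
  "(vector [a, b, c, d] :: 'a::zero ^ 4) $ 3 = c"
  "(vector [a, b, c, d] :: 'a::zero ^ 4) $ 4 = d"
  unfolding vector_def by auto

lemma quat_eq_iff:
  "(x :: real ^ 4) = y \<longleftrightarrow> x $ 1 = y $ 1 \<and> x $ 2 = y $ 2 \<and> x $ 3 = y $ 3 \<and> x $ 4 = y $ 4"
  by (simp add: vec_eq_iff forall_4)

lemma quat_norm_eq_1_iff:
  "norm (x :: real ^ 4) = 1 \<longleftrightarrow> (x $ 1)\<^sup>2 + (x $ 2)\<^sup>2 + (x $ 3)\<^sup>2 + (x $ 4)\<^sup>2 = 1"
  by (simp add: norm_vec_def L2_set_def sum_4)

lemma quat_relations:
  "quat_mult quat_i quat_i = - quat_one"
  "quat_mult quat_j quat_j = - quat_one"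
  "quat_mult quat_k quat_k = - quat_one"
  "quat_mult (quat_mult quat_i quat_j) quat_k = - quat_one"
  by (simp_all add: quat_eq_iff quat_mult_def quat_one_def quat_i_def quat_j_def quat_k_def)

lemma bilinear_quat_mult: "bilinear quat_mult"
  unfolding bilinear_def
  by (intro conjI allI linearI) (simp_all add: quat_eq_iff quat_mult_def algebra_simps)

lemma quat_mult_assoc: "quat_mult (quat_mult x y) z = quat_mult x (quat_mult y z)"
  by (simp add: quat_eq_iff quat_mult_def algebra_simps)

lemma quat_mult_one: "quat_mult quat_one x = x" "quat_mult x quat_one = x"
  by (simp_all add: quat_eq_iff quat_mult_def quat_one_def)

lemma norm_quat_mult_eq_1:
  assumes "norm x = 1" "norm y = 1"
  shows "norm (quat_mult x y) = 1"
proof -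
  let ?N = "\<lambda>x :: real ^ 4. (x $ 1)\<^sup>2 + (x $ 2)\<^sup>2 + (x $ 3)\<^sup>2 + (x $ 4)\<^sup>2"
  have "?N (quat_mult x y) = ?N x * ?N y"
    unfolding quat_mult_def vector_4_nth
    by (simp add: power2_eq_square algebra_simps)
  with assms show ?thesis by (simp add: quat_norm_eq_1_iff)
qed

definition quat_cnj :: "real ^ 4 \<Rightarrow> real ^ 4" where
  "quat_cnj x = vector [x $ 1, - x $ 2, - x $ 3, - x $ 4]"

lemma quat_cnj_mult:
  assumes "norm x = 1"
  shows "quat_mult (quat_cnj x) x = quat_one"
  using assms[unfolded quat_norm_eq_1_iff]
  unfolding quat_eq_iff quat_mult_def quat_one_def quat_cnj_def vector_4_nth power2_eq_square
  by (intro conjI) (linarith, simp_all)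

lemma norm_quat_cnj: "norm x = 1 \<Longrightarrow> norm (quat_cnj x) = 1"
  by (simp add: quat_norm_eq_1_iff quat_cnj_def)

lemma norm_quat_one: "norm quat_one = 1"
  by (simp add: quat_norm_eq_1_iff quat_one_def)

lemma group_unit_quaternions: "group unit_quaternions"
proof (rule groupI)
  fix x assume "x \<in> carrier unit_quaternions"
  then show "\<exists>y\<in>carrier unit_quaternions. mult unit_quaternions y x = one unit_quaternions"
    by (intro bexI[of _ "quat_cnj x"])
      (simp_all add: unit_quaternions_def quat_cnj_mult norm_quat_cnj)
qed (auto simp: unit_quaternions_def norm_quat_mult_eq_1 quat_mult_assoc quat_mult_one
      norm_quat_one)

lemma inv_unit_quaternions:
  assumes "x \<in> carrier unit_quaternions"
  shows "m_inv unit_quaternions x = quat_cnj x"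
  using group.inv_equality[OF group_unit_quaternions, of "quat_cnj x" x] assms
  by (simp add: unit_quaternions_def quat_cnj_mult norm_quat_cnj)

lemma continuous_on_mult_unit_quaternions:
  "continuous_on (carrier unit_quaternions \<times> carrier unit_quaternions)
     (\<lambda>(x, y). mult unit_quaternions x y)"
  unfolding unit_quaternions_def case_prod_beta monoid.simps
  by (intro bounded_bilinear.continuous_on[OF
        bilinear_conv_bounded_bilinear[THEN iffD1, OF bilinear_quat_mult]] continuous_intros)

lemma continuous_on_inv_unit_quaternions:
  "continuous_on (carrier unit_quaternions) (m_inv unit_quaternions)"
proof -
  have "linear quat_cnj"
    by (intro linearI) (simp_all add: quat_eq_iff quat_cnj_def)
  then have "continuous_on (carrier unit_quaternions) quat_cnj"
    by (rule linear_continuous_on[OF linear_conv_bounded_linear[THEN iffD1]])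
  then show ?thesis
    by (rule continuous_on_eq) (simp add: inv_unit_quaternions)
qed

end

theory Submission
  imports Defs "HOL-Homology.Brouwer_Degree" "HOL-Combinatorics.Transposition"
begin

text \<open>
  On unit quaternions inversion is conjugation, which negates three of the four coordinates and
  hence has Brouwer degree \<open>-1\<close> on the 3-sphere.  If \<open>f\<close> is inverse ambiguous and continuous,
  then \<open>f \<circ> f\<close> is the inversion, and multiplicativity of the degree makes \<open>-1\<close> a
  square in \<open>\<int>\<close>.
\<close>

text \<open>Points of \<open>nsphere p\<close> are functions on \<open>nat\<close> with coordinates
  numbered from 0, so quaternion conjugation becomes the case \<open>A = {1, 2, 3}\<close>.\<close>

definition negate_coords :: "nat set \<Rightarrow> (nat \<Rightarrow> real) \<Rightarrow> nat \<Rightarrow> real" where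
  "negate_coords A x = (\<lambda>i. if i \<in> A then - x i else x i)"

text \<open>Swapping two indices in \<open>{..p}\<close> only permutes the summands of the squared
  norm and fixes every index beyond \<open>p\<close>, where points of the sphere vanish.\<close>

lemma continuous_map_nsphere_comp_transpose:
  assumes "j \<le> p" "k \<le> p"
  shows "continuous_map (nsphere p) (nsphere p) (\<lambda>x. x \<circ> Transposition.transpose j k)"
proof -
  have "(\<Sum>i\<le>p. (x (Transposition.transpose j k i))\<^sup>2) = (\<Sum>i\<le>p. (x i)\<^sup>2)" for x :: "nat \<Rightarrow> real"
    by (rule sum.reindex_bij_betw[where g = "\<lambda>i. (x i)\<^sup>2"])
      (use assms in \<open>auto simp: bij_betw_transpose_iff\<close>)
  moreover have "Transposition.transpose j k i = i" if "i > p" for i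
    using assms that by (auto simp: Transposition.transpose_def)
  moreover have "continuous_map (nsphere p) (powertop_real UNIV) (\<lambda>x. x \<circ> Transposition.transpose j k)"
    by (simp add: continuous_map_componentwise_UNIV continuous_map_nsphere_projection)
  ultimately show ?thesis
    by (subst (2) nsphere) (auto simp: continuous_map_in_subtopology nsphere)
qed

text \<open>The reflection in coordinate \<open>k\<close> is conjugate, by the swap \<open>s\<close>
  of coordinates 0 and \<open>k\<close>, to the reflection in coordinate 0, whose degree is known.
  The degree of \<open>s\<close> enters only through its square, which is 1 because \<open>s\<close>
  is an involution.\<close>

lemma Brouwer_degree2_reflection_at:
  assumes "k \<le> p"
  shows "Brouwer_degree2 p (\<lambda>x i. if i = k then - x i else x i) = -1"
proof -
  define s where "s = (\<lambda>x :: nat \<Rightarrow> real. x \<circ> Transposition.transpose 0 k)"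
  define r where "r = (\<lambda>x :: nat \<Rightarrow> real. \<lambda>i. if i = 0 then - x i else x i)"
  have s: "continuous_map (nsphere p) (nsphere p) s"
    unfolding s_def using assms by (intro continuous_map_nsphere_comp_transpose) auto
  have r: "continuous_map (nsphere p) (nsphere p) r"
    unfolding r_def by (rule continuous_map_nsphere_reflection)
  have "s \<circ> s = id"
    by (simp add: s_def fun_eq_iff)
  then have ss: "Brouwer_degree2 p s * Brouwer_degree2 p s = 1"
    using Brouwer_degree2_compose[OF s s] by simp
  \<comment> \<open>Move coordinate \<open>k\<close> to position 0, negate it there, and move it
    back.\<close>
  have "(\<lambda>x i. if i = k then - x i else x i) = s \<circ> (r \<circ> s)"
    by (auto simp: s_def r_def fun_eq_iff Transposition.transpose_def)
  moreover have "Brouwer_degree2 p (s \<circ> (r \<circ> s)) = - (Brouwer_degree2 p s * Brouwer_degree2 p s)"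
    using Brouwer_degree2_reflection[of p]
    by (simp add: Brouwer_degree2_compose continuous_map_compose[OF s r] r s flip: r_def)
  ultimately show ?thesis
    using ss by simp
qed

text \<open>The map is a composition of one reflection for each element of \<open>A\<close>, and
  each reflection contributes a factor -1 to the degree.\<close>

lemma Brouwer_degree2_negate_coords:
  assumes "A \<subseteq> {..p}"
  shows "continuous_map (nsphere p) (nsphere p) (negate_coords A) \<and>
         Brouwer_degree2 p (negate_coords A) = (-1) ^ card A"
  using finite_subset[OF assms finite_atMost] assms
proof (induction A rule: finite_induct)
  case empty
  have "negate_coords {} = id"
    by (simp add: negate_coords_def fun_eq_iff)
  then show ?case
    using Brouwer_degree2_id[of p] by (simp only: continuous_map_id card.empty power_0)
next
  case (insert k A)
  define r where "r = (\<lambda>x :: nat \<Rightarrow> real. \<lambda>i. if i = k then - x i else x i)"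
  have r: "continuous_map (nsphere p) (nsphere p) r"
    unfolding r_def by (rule continuous_map_nsphere_reflection)
  have "Brouwer_degree2 p r = -1"
    unfolding r_def using insert.prems by (intro Brouwer_degree2_reflection_at) auto
  \<comment> \<open>This relies on \<open>k\<close> lying outside \<open>A\<close>: otherwise the
    two sign changes at \<open>k\<close> would cancel.\<close>
  moreover have "negate_coords (insert k A) = r \<circ> negate_coords A"
    using insert.hyps by (auto simp: negate_coords_def r_def fun_eq_iff)
  ultimately show ?case
    using insert.hyps insert.IH insert.prems Brouwer_degree2_compose[OF _ r]
      continuous_map_compose[OF _ r]
    by (metis card_insert_disjoint insert_subset power_Suc)
qed

lemma no_square_root_negate_coords:
  assumes "A \<subseteq> {..p}" "odd (card A)"
    and f: "continuous_map (nsphere p) (nsphere p) f"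
    and eq: "\<And>x. x \<in> topspace (nsphere p) \<Longrightarrow> f (f x) = negate_coords A x"
  shows False
proof -
  have "(Brouwer_degree2 p f)\<^sup>2 = Brouwer_degree2 p (f \<circ> f)"
    using Brouwer_degree2_compose[OF f f] by (simp add: power2_eq_square)
  \<comment> \<open>The degree depends only on the values on the sphere, which is where
    \<open>eq\<close> gives agreement.\<close>
  also have "\<dots> = Brouwer_degree2 p (negate_coords A)"
    by (rule Brouwer_degree2_eq) (simp add: eq)
  also have "\<dots> = -1"
    using Brouwer_degree2_negate_coords[OF assms(1)] assms(2) by simp
  finally show False
    using zero_le_power2[of "Brouwer_degree2 p f"] by simp
qed

text \<open>The degree is defined for \<open>nsphere p\<close>, whose coordinates are indexed by
  \<open>nat\<close>, whereas vectors are indexed by a finite type. The bijection \<open>e\<close>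
  relabels coordinates and so preserves the sum of squares; the value 0 beyond \<open>p\<close> is
  what \<open>nsphere\<close> demands.\<close>

lemma homeomorphic_maps_sphere_nsphere:
  fixes e :: "'n :: finite \<Rightarrow> nat"
  assumes e: "bij_betw e UNIV {..p}"
  shows "homeomorphic_maps (top_of_set {x :: real ^ 'n. norm x = 1}) (nsphere p)
           (\<lambda>x i. if i \<le> p then x $ inv_into UNIV e i else 0) (\<lambda>y. \<chi> i. y (e i))"
proof -
  have inj: "inj e" and le: "e i \<le> p" for i
    using e by (auto simp: bij_betw_def)
  have e_inv: "e (inv_into UNIV e i) = i" if "i \<le> p" for i
    using e that by (auto simp: bij_betw_def intro: f_inv_into_f)
  have sum_e: "(\<Sum>i\<in>UNIV. (g (e i))\<^sup>2) = (\<Sum>i\<le>p. (g i)\<^sup>2)" for g :: "nat \<Rightarrow> real"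
    by (rule sum.reindex_bij_betw[OF e])
  have norm_iff: "norm x = 1 \<longleftrightarrow> (\<Sum>i\<in>UNIV. (x $ i)\<^sup>2) = 1" for x :: "real ^ 'n"
    by (simp add: norm_vec_def L2_set_def)
  have sum_inv: "(\<Sum>i\<le>p. (x $ inv_into UNIV e i)\<^sup>2) = (\<Sum>i\<in>UNIV. (x $ i)\<^sup>2)" for x :: "real ^ 'n"
    using sum_e[of "\<lambda>i. x $ inv_into UNIV e i"] inj by simp
  have "continuous_map (top_of_set {x :: real ^ 'n. norm x = 1}) (nsphere p)
          (\<lambda>x i. if i \<le> p then x $ inv_into UNIV e i else 0)"
    unfolding nsphere continuous_map_in_subtopology continuous_map_componentwise_UNIV
    by (auto simp: norm_iff sum_inv intro: continuous_intros)
  moreover have "continuous_map (nsphere p) (top_of_set {x :: real ^ 'n. norm x = 1})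
      (\<lambda>y. \<chi> i. y (e i))"
    unfolding nsphere euclidean_product_topology continuous_map_in_subtopology
    by (auto simp: norm_iff sum_e intro!: continuous_on_vec_lambda
          continuous_on_product_then_coordinatewise[OF continuous_on_id])
  ultimately show ?thesis
    unfolding homeomorphic_maps_def using inj le e_inv
    by (auto simp: nsphere fun_eq_iff vec_eq_iff)
qed

text \<open>Evaluating the defining condition at \<open>f x\<close> makes \<open>x\<close> the
  inverse of \<open>f (f x)\<close>; inverting once more gives the claim.\<close>

lemma inverse_ambiguous_apply_twice:
  assumes "group G" "inverse_ambiguous G f" "x \<in> carrier G"
  shows "f (f x) = inv\<^bsub>G\<^esub> x"
proof -
  interpret group G by fact
  have bij: "bij_betw f (carrier G) (carrier G)"
    using assms(2) by (simp add: inverse_ambiguous_def)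
  have fx: "f x \<in> carrier G" and ffx: "f (f x) \<in> carrier G"
    using bij_betwE[OF bij] assms(3) by auto
  have "inv_into (carrier G) f (f x) = inv\<^bsub>G\<^esub> (f (f x))"
    using assms(2) fx by (simp add: inverse_ambiguous_def)
  then have "x = inv\<^bsub>G\<^esub> (f (f x))"
    using bij assms(3) by (simp add: bij_betw_def)
  then show ?thesis
    using inv_inv[OF ffx] by simp
qed

theorem theorem4p6:
  shows "\<not> (\<exists>f. continuous_map (top_of_set (carrier unit_quaternions))
                              (top_of_set (carrier unit_quaternions)) f \<and>
               inverse_ambiguous unit_quaternions f)"
proof safe
  fix f
  assume f: "continuous_map (top_of_set (carrier unit_quaternions))
                            (top_of_set (carrier unit_quaternions)) f"
    and amb: "inverse_ambiguous unit_quaternions f"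
  \<comment> \<open>The real part gets index 0 and the three imaginary parts get 1, 2, 3. The last
    case covers \<open>4 :: 4\<close>, which equals 0 in the index type.\<close>
  define e :: "4 \<Rightarrow> nat" where
    "e i = (if i = 1 then 0 else if i = 2 then 1 else if i = 3 then 2 else 3)" for i
  define g where "g x i = (if i \<le> 3 then x $ inv_into UNIV e i else 0)" for x :: "real ^ 4" and i
  define h where "h y = (\<chi> i. y (e i))" for y :: "nat \<Rightarrow> real"
  have e_nth: "e 1 = 0" "e 2 = 1" "e 3 = 2" "e 4 = 3"
    by (simp_all add: e_def)
  have inj: "inj e"
    unfolding inj_def forall_4 by (simp add: e_nth)
  have "e ` UNIV = {..3}"
    unfolding UNIV_4 by (auto simp: e_nth)
  with inj have "bij_betw e UNIV {..3}"
    by (simp add: bij_betw_def)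
  from homeomorphic_maps_sphere_nsphere[OF this]
  have gh: "homeomorphic_maps (top_of_set (carrier unit_quaternions)) (nsphere 3) g h"
    unfolding g_def[abs_def] h_def[abs_def] by (simp add: unit_quaternions_def)
  then have g: "continuous_map (top_of_set (carrier unit_quaternions)) (nsphere 3) g"
    and h: "continuous_map (nsphere 3) (top_of_set (carrier unit_quaternions)) h"
    by (auto simp: homeomorphic_maps_def)
  \<comment> \<open>\<open>Suc 0\<close> is the form into which the simplifier puts the index
    1.\<close>
  have inv_e: "inv_into UNIV e 0 = 1" "inv_into UNIV e (Suc 0) = 2" "inv_into UNIV e 2 = 3" "inv_into UNIV e 3 = 4"
    using inv_f_f[OF inj, of 1] inv_f_f[OF inj, of 2] inv_f_f[OF inj, of 3] inv_f_f[OF inj, of 4]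
    by (simp_all add: e_nth)
  \<comment> \<open>Transported to \<open>nsphere 3\<close>, \<open>f\<close> becomes a square root
    of the transported conjugation.\<close>
  have "continuous_map (nsphere 3) (nsphere 3) (g \<circ> f \<circ> h)"
    by (intro continuous_map_compose[OF h] continuous_map_compose[OF f] g)
  moreover have "(g \<circ> f \<circ> h) ((g \<circ> f \<circ> h) y) = negate_coords {1, 2, 3} y"
    if y: "y \<in> topspace (nsphere 3)" for y
  proof -
    have hy: "h y \<in> carrier unit_quaternions"
      using h y by (auto simp: continuous_map_def)
    then have "f (h y) \<in> carrier unit_quaternions"
      using f by (auto simp: continuous_map_def)
    then have "h (g (f (h y))) = f (h y)"
      using gh by (simp add: homeomorphic_maps_def)
    then have "(g \<circ> f \<circ> h) ((g \<circ> f \<circ> h) y) = g (quat_cnj (h y))"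
      using inverse_ambiguous_apply_twice[OF group_unit_quaternions amb hy]
      by (simp add: inv_unit_quaternions[OF hy])
    also have "\<dots> = negate_coords {1, 2, 3} y"
    proof
      \<comment> \<open>For \<open>i > 3\<close> both sides are 0: the left by the default value in
        \<open>g\<close>, the right because \<open>y\<close> lies on
        \<open>nsphere 3\<close>.\<close>
      fix i :: nat
      consider "i = 0" | "i = 1" | "i = 2" | "i = 3" | "i > 3" by linarith
      then show "g (quat_cnj (h y)) i = negate_coords {1, 2, 3} y i"
        by cases
          (use y in \<open>auto simp: g_def h_def inv_e e_nth quat_cnj_def negate_coords_def nsphere\<close>)
    qed
    finally show ?thesis .
  qed
  ultimately show False
    by (intro no_square_root_negate_coords[of "{1, 2, 3}" 3 "g \<circ> f \<circ> h"]) auto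
qed

end
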